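(* The class of Cayley polynomial-time computable groups is closed under taking a finitely generated subgroup. The same holds for the class of Cayley polynomial-time computable groups with quasigeodesic normal forms.
   Context: A function $f:\Sigma^*\to\Sigma^*$ is polynomial-time computable if it is computed by a deterministic one-tape Turing machine in time $O(p(n))$, where $p$ is a polynomial and $n$ is the length of the input. Let $G$ be a finitely generated group and $S=\{s_1,\dots,s_n\}\subseteq G$ a finite set of semigroup generators (every $g\in G$ is a product of elements of $S$). $G$ is Cayley polynomial-time computable if there exist a language $L\subseteq\Sigma^*$ (no restriction on the language class) over a finite alphabet $\Sigma$, a bijection $\psi:L\to G$ and polynomial-time computable functions $f_i:\Sigma^*\to\Sigma^*$, $i=1,\dots,n$, with $f_i(L)\subseteq L$ and $\psi(f_i(w))=\psi(w)s_i$ for all $w\in L$; such $\psi$ is a Cayley polynomial-time computable representation. This does not depend on the choice of $S$. Let $A$ be a finite generating set of $G$ and let $d_A(g)$ be the length of a shortest word over $A\cup A^{-1}$ representing $g$. A bijection $\psi:L\to G$ has quasigeodesic normal form if there is a constant $C$ such that $|w|\leqslant C(d_A(\psi(w))+1)$ for all $w\in L$. $G$ is Cayley polynomial-time computable with quasigeodesic normal form if it admits a Cayley polynomial-time computable representation which has quasigeodesic normal form. *)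

theory Defs
  imports
    "HOL-Algebra.Generated_Groups"
    "HOL-Computational_Algebra.Polynomial"
    "HOL-Library.Landau_Symbols"
begin

text \<open>
  Deterministic one-tape Turing machines. The tape is infinite to the right; its leftmost cell
  carries the end marker \<open>LeftEnd\<close>, which occurs nowhere else and cannot be overwritten.
  Alphabets are finite sets of natural numbers; wrapping letters in \<open>Sym\<close> keeps the
  marker and the blank outside every alphabet.
\<close>

datatype cell = LeftEnd | Blank | Sym nat

datatype move = MoveL | Stay | MoveR

record tm =
  tm_states :: "nat set"
  tm_letters :: "nat set"
  tm_start :: nat
  tm_final :: "nat set"
  tm_trans :: "nat \<Rightarrow> cell \<Rightarrow> nat \<times> cell \<times> move"

definition tm_cells :: "tm \<Rightarrow> cell set" where
  "tm_cells M = {LeftEnd, Blank} \<union> Sym ` tm_letters M"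

text \<open>
  Only the values of \<open>tm_trans\<close> on non-final states and on tape symbols of the machine
  matter, so only these are constrained.
\<close>

definition valid_tm :: "nat set \<Rightarrow> tm \<Rightarrow> bool" where
  "valid_tm \<Sigma> M \<longleftrightarrow>
     finite (tm_states M) \<and> finite (tm_letters M) \<and> \<Sigma> \<subseteq> tm_letters M \<and>
     tm_start M \<in> tm_states M \<and> tm_final M \<subseteq> tm_states M \<and>
     (\<forall>q \<in> tm_states M - tm_final M. \<forall>c \<in> tm_cells M. \<forall>q' c' m.
        tm_trans M q c = (q', c', m) \<longrightarrow>
          q' \<in> tm_states M \<and> c' \<in> tm_cells M \<and>
          (c' = LeftEnd \<longleftrightarrow> c = LeftEnd) \<and> (c = LeftEnd \<longrightarrow> m \<noteq> MoveL))"

text \<open>A configuration consists of the state, the tape and the head position.\<close>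

type_synonym config = "nat \<times> (nat \<Rightarrow> cell) \<times> nat"

definition word_tape :: "nat list \<Rightarrow> nat \<Rightarrow> cell" where
  "word_tape w i =
     (if i = 0 then LeftEnd else if i \<le> length w then Sym (w ! (i - 1)) else Blank)"

definition tm_init :: "tm \<Rightarrow> nat list \<Rightarrow> config" where
  "tm_init M w = (tm_start M, word_tape w, 0)"

fun move_head :: "move \<Rightarrow> nat \<Rightarrow> nat" where
  "move_head MoveL h = h - 1"
| "move_head Stay h = h"
| "move_head MoveR h = h + 1"

text \<open>
  Configurations in a final state are fixed points, so that ``halted within \<open>t\<close> steps''
  is the same as ``in a final state after exactly \<open>t\<close> iterations''.
\<close>

fun tm_step :: "tm \<Rightarrow> config \<Rightarrow> config" where
  "tm_step M (q, tape, h) =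
     (if q \<in> tm_final M then (q, tape, h)
      else case tm_trans M q (tape h) of
             (q', c', m) \<Rightarrow> (q', tape(h := c'), move_head m h))"

text \<open>
  On halting, the tape holds exactly the output word between the marker and the blanks;
  the head may be anywhere.
\<close>

definition tm_computes_in_time ::
    "nat set \<Rightarrow> tm \<Rightarrow> (nat list \<Rightarrow> nat list) \<Rightarrow> (nat \<Rightarrow> nat) \<Rightarrow> bool" where
  "tm_computes_in_time \<Sigma> M f T \<longleftrightarrow>
     (\<forall>w \<in> lists \<Sigma>. \<exists>t \<le> T (length w). \<exists>q h.
        (tm_step M ^^ t) (tm_init M w) = (q, word_tape (f w), h) \<and> q \<in> tm_final M)"

definition ptime_computable :: "nat set \<Rightarrow> (nat list \<Rightarrow> nat list) \<Rightarrow> bool" where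
  "ptime_computable \<Sigma> f \<longleftrightarrow>
     f ` lists \<Sigma> \<subseteq> lists \<Sigma> \<and>
     (\<exists>M T. \<exists>p :: real poly. valid_tm \<Sigma> M \<and> tm_computes_in_time \<Sigma> M f T \<and>
        (\<lambda>n. real (T n)) \<in> O(\<lambda>n. poly p (real n)))"

definition word_prod :: "('a, 'b) monoid_scheme \<Rightarrow> 'a list \<Rightarrow> 'a" where
  "word_prod G ws = foldr (\<otimes>\<^bsub>G\<^esub>) ws \<one>\<^bsub>G\<^esub>"

definition finite_semigroup_generators :: "('a, 'b) monoid_scheme \<Rightarrow> 'a set \<Rightarrow> bool" where
  "finite_semigroup_generators G S \<longleftrightarrow>
     finite S \<and> S \<subseteq> carrier G \<and> (\<forall>g \<in> carrier G. \<exists>ws \<in> lists S. word_prod G ws = g)"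

definition finite_group_generators :: "('a, 'b) monoid_scheme \<Rightarrow> 'a set \<Rightarrow> bool" where
  "finite_group_generators G A \<longleftrightarrow>
     finite A \<and> A \<subseteq> carrier G \<and> generate G A = carrier G"

definition finitely_generated_group :: "('a, 'b) monoid_scheme \<Rightarrow> bool" where
  "finitely_generated_group G \<longleftrightarrow> group G \<and> (\<exists>A. finite_group_generators G A)"

definition cayley_ptime_representation ::
    "('a, 'b) monoid_scheme \<Rightarrow> 'a set \<Rightarrow> nat set \<Rightarrow> nat list set \<Rightarrow> (nat list \<Rightarrow> 'a) \<Rightarrow> bool" where
  "cayley_ptime_representation G S \<Sigma> L \<psi> \<longleftrightarrow>
     finite \<Sigma> \<and> L \<subseteq> lists \<Sigma> \<and> bij_betw \<psi> L (carrier G) \<and>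
     (\<forall>s \<in> S. \<exists>f. ptime_computable \<Sigma> f \<and> f ` L \<subseteq> L \<and>
        (\<forall>w \<in> L. \<psi> (f w) = \<psi> w \<otimes>\<^bsub>G\<^esub> s))"

definition cayley_ptime_group :: "('a, 'b) monoid_scheme \<Rightarrow> bool" where
  "cayley_ptime_group G \<longleftrightarrow>
     finitely_generated_group G \<and>
     (\<exists>S \<Sigma> L \<psi>. finite_semigroup_generators G S \<and> cayley_ptime_representation G S \<Sigma> L \<psi>)"

definition word_length :: "('a, 'b) monoid_scheme \<Rightarrow> 'a set \<Rightarrow> 'a \<Rightarrow> nat" where
  "word_length G A g =
     (LEAST n. \<exists>ws \<in> lists (A \<union> m_inv G ` A). length ws = n \<and> word_prod G ws = g)"

definition quasigeodesic_normal_form ::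
    "('a, 'b) monoid_scheme \<Rightarrow> 'a set \<Rightarrow> nat list set \<Rightarrow> (nat list \<Rightarrow> 'a) \<Rightarrow> bool" where
  "quasigeodesic_normal_form G A L \<psi> \<longleftrightarrow>
     (\<exists>C :: real. \<forall>w \<in> L. real (length w) \<le> C * (real (word_length G A (\<psi> w)) + 1))"

definition cayley_ptime_quasigeodesic_group :: "('a, 'b) monoid_scheme \<Rightarrow> bool" where
  "cayley_ptime_quasigeodesic_group G \<longleftrightarrow>
     finitely_generated_group G \<and>
     (\<exists>S A \<Sigma> L \<psi>. finite_semigroup_generators G S \<and> finite_group_generators G A \<and>
        cayley_ptime_representation G S \<Sigma> L \<psi> \<and> quasigeodesic_normal_form G A L \<psi>)"

end

theory Submission
  imports Defs
begin

text \<open>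
  Let \<open>\<psi>\<close> be a representation of \<open>G\<close> with domain \<open>L\<close>, and restrict it to
  \<open>{w \<in> L. \<psi> w \<in> H}\<close>; this is a bijection onto \<open>H\<close>. An element \<open>b\<close> of a finite symmetric
  generating set of \<open>H\<close> is a product \<open>s\<^sub>1 \<dots> s\<^sub>k\<close> of the generators of \<open>G\<close>, so right
  multiplication by \<open>b\<close> is computed on normal forms by the composition of the functions
  belonging to \<open>s\<^sub>1, \<dots>, s\<^sub>k\<close> (\<open>word_multiplier\<close>), and this composition maps the restricted
  language into itself because \<open>b \<in> H\<close>. Membership in \<open>H\<close> may be undecidable; this is
  harmless because the language of a representation is an arbitrary set of words.

  The machine-theoretic content is that polynomial-time computable functions are closed under
  composition (\<open>ptime_computable_comp\<close>). A halting machine leaves nothing but its output on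
  the tape, so after rewinding the head to the end marker a second machine can start at once.
  The output of a machine is at most as long as its input plus its running time, so the
  composed running time is again polynomially bounded.

  For quasigeodesic normal forms, write each of the finitely many generators of \<open>H\<close> as a word
  over the generators of \<open>G\<close>, of length at most \<open>K\<close> say. Then \<open>d\<^sub>A(h) \<le> K d\<^sub>B(h)\<close>
  for \<open>h \<in> H\<close> (\<open>word_length_subgroup_le\<close>), and a linear bound on \<open>|w|\<close> in terms of
  \<open>d\<^sub>A\<close> yields one in terms of \<open>d\<^sub>B\<close>.
\<close>

section \<open>Polynomial time bounds\<close>

text \<open>
  Polynomials with natural coefficients are monotone, so as time bounds they can be composed;
  a bounding function that is merely \<open>O\<close> of a real polynomial need not be monotone.
\<close>

lemma poly_nat_mono:
  fixes p :: "nat poly"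
  assumes "m \<le> n"
  shows "poly p m \<le> poly p n"
  by (induction p) (auto intro!: add_mono mult_mono assms)

lemma poly_map_poly_real: "poly (map_poly real p) (real n) = real (poly p n)"
  by (induction p) (auto simp: map_poly_pCons)

lemma abs_poly_le_nat_poly:
  fixes p :: "real poly"
  shows "\<bar>poly p (real n)\<bar> \<le> real (poly (map_poly (\<lambda>a. nat \<lceil>\<bar>a\<bar>\<rceil>) p) n)"
proof (induction p)
  case (pCons a p)
  let ?q = "map_poly (\<lambda>a. nat \<lceil>\<bar>a\<bar>\<rceil>) p"
  have "\<bar>poly (pCons a p) (real n)\<bar> \<le> \<bar>a\<bar> + real n * \<bar>poly p (real n)\<bar>"
    by (simp add: order.trans[OF abs_triangle_ineq] abs_mult)
  also have "\<dots> \<le> real (nat \<lceil>\<bar>a\<bar>\<rceil>) + real n * real (poly ?q n)"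
    by (intro add_mono mult_left_mono pCons.IH) (auto simp: real_nat_ceiling_ge)
  finally show ?case
    by (simp add: map_poly_pCons)
qed simp

lemma bigo_poly_imp_le_nat_poly:
  fixes p :: "real poly"
  assumes "(\<lambda>n. real (T n)) \<in> O(\<lambda>n. poly p (real n))"
  obtains q :: "nat poly" where "\<And>n. T n \<le> poly q n"
proof -
  obtain c where "c > 0"
    and ev: "eventually (\<lambda>n. norm (real (T n)) \<le> c * norm (poly p (real n))) at_top"
    using assms by (rule landau_o.bigE)
  obtain N where N: "real (T n) \<le> c * \<bar>poly p (real n)\<bar>" if "n \<ge> N" for n
    using ev by (auto simp: eventually_at_top_linorder)
  \<comment> \<open>The constant summand covers the arguments below \<open>N\<close>, where the estimate may fail.\<close>
  define p' where "p' = map_poly (\<lambda>a. nat \<lceil>\<bar>a\<bar>\<rceil>) p"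
  define q where "q = smult (nat \<lceil>c\<rceil>) p' + [:\<Sum>i<N. T i:]"
  have "T n \<le> poly q n" for n
  proof (cases "n < N")
    case True
    have "T n \<le> (\<Sum>i<N. T i)"
      using True by (intro member_le_sum) auto
    then show ?thesis
      by (simp add: q_def)
  next
    case False
    then have "real (T n) \<le> c * \<bar>poly p (real n)\<bar>"
      by (intro N) simp
    also have "\<dots> \<le> real (nat \<lceil>c\<rceil>) * real (poly p' n)"
      using \<open>c > 0\<close> abs_poly_le_nat_poly[of p n]
      by (intro mult_mono) (auto simp: p'_def real_nat_ceiling_ge)
    finally have "T n \<le> nat \<lceil>c\<rceil> * poly p' n"
      by (metis of_nat_le_iff of_nat_mult)
    then show ?thesis
      by (simp add: q_def)
  qed
  then show thesis
    using that by blast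
qed

lemma tm_computes_in_time_mono:
  assumes "tm_computes_in_time \<Sigma> M f T" "\<And>n. T n \<le> T' n"
  shows "tm_computes_in_time \<Sigma> M f T'"
  using assms unfolding tm_computes_in_time_def by (meson order.trans)

lemma ptime_computable_iff_nat_poly:
  "ptime_computable \<Sigma> f \<longleftrightarrow>
     f ` lists \<Sigma> \<subseteq> lists \<Sigma> \<and>
     (\<exists>M. \<exists>p :: nat poly. valid_tm \<Sigma> M \<and> tm_computes_in_time \<Sigma> M f (poly p))"
  (is "_ \<longleftrightarrow> ?R")
proof
  assume f: "ptime_computable \<Sigma> f"
  then obtain M T and p :: "real poly" where M: "valid_tm \<Sigma> M" "tm_computes_in_time \<Sigma> M f T"
    and T: "(\<lambda>n. real (T n)) \<in> O(\<lambda>n. poly p (real n))"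
    unfolding ptime_computable_def by blast
  obtain q :: "nat poly" where q: "\<And>n. T n \<le> poly q n"
    using bigo_poly_imp_le_nat_poly[OF T] by blast
  have "f ` lists \<Sigma> \<subseteq> lists \<Sigma>"
    using f by (simp only: ptime_computable_def)
  with M(1) tm_computes_in_time_mono[OF M(2) q] show ?R
    by blast
next
  assume R: ?R
  then obtain M and p :: "nat poly"
    where M: "valid_tm \<Sigma> M" "tm_computes_in_time \<Sigma> M f (poly p)"
    by blast
  have "(\<lambda>n. real (poly p n)) \<in> O(\<lambda>n. poly (map_poly real p) (real n))"
    by (simp add: poly_map_poly_real)
  with M have "\<exists>M T. \<exists>p :: real poly. valid_tm \<Sigma> M \<and> tm_computes_in_time \<Sigma> M f T \<and>
      (\<lambda>n. real (T n)) \<in> O(\<lambda>n. poly p (real n))"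
    by (intro exI conjI)
  with R show "ptime_computable \<Sigma> f"
    unfolding ptime_computable_def by (intro conjI) simp_all
qed

section \<open>Running a Turing machine\<close>

lemma tm_final_funpow:
  assumes "q \<in> tm_final M"
  shows "(tm_step M ^^ t) (q, tape, h) = (q, tape, h)"
  using assms by (induction t) auto

text \<open>
  The transition function is constrained only on the states and symbols of the machine, so a
  simulation of the machine is faithful only as long as a run stays among these.
\<close>

definition tm_config_ok :: "tm \<Rightarrow> config \<Rightarrow> bool" where
  "tm_config_ok M c \<longleftrightarrow> fst c \<in> tm_states M \<and> range (fst (snd c)) \<subseteq> tm_cells M"

lemma tm_config_ok_step:
  assumes "valid_tm \<Sigma> M" "tm_config_ok M c"
  shows "tm_config_ok M (tm_step M c)"
proof -
  obtain q tape h where c: "c = (q, tape, h)"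
    by (cases c)
  obtain q' x m where tr: "tm_trans M q (tape h) = (q', x, m)"
    by (cases "tm_trans M q (tape h)")
  have "q' \<in> tm_states M \<and> x \<in> tm_cells M" if "q \<notin> tm_final M"
    using assms that tr unfolding valid_tm_def tm_config_ok_def c
    by (metis (no_types, lifting) DiffI fst_conv snd_conv range_subsetD)
  then show ?thesis
    using assms(2) tr by (auto simp: c tm_config_ok_def)
qed

lemma tm_config_ok_word_tape:
  assumes "valid_tm \<Sigma> M" "w \<in> lists \<Sigma>" "q \<in> tm_states M"
  shows "tm_config_ok M (q, word_tape w, h)"
proof -
  have "set w \<subseteq> tm_letters M"
    using assms(1,2) by (auto simp: valid_tm_def)
  then have "w ! (i - 1) \<in> tm_letters M" if "i \<noteq> 0" "i \<le> length w" for i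
    using nth_mem[of "i - 1" w] that by auto
  then have "word_tape w i \<in> tm_cells M" for i
    by (simp add: word_tape_def tm_cells_def)
  then show ?thesis
    using assms(3) by (auto simp: tm_config_ok_def)
qed

text \<open>
  The head moves by at most one cell per step, which bounds both its final position and the
  part of the tape that can have been written.
\<close>

lemma tm_run_extent:
  assumes "(tm_step M ^^ t) (tm_init M w) = (q, tape, h)"
  shows "h \<le> t \<and> (\<forall>i. t \<le> i \<longrightarrow> length w < i \<longrightarrow> tape i = Blank)"
  using assms
proof (induction t arbitrary: q tape h)
  case 0
  then show ?case
    by (auto simp: tm_init_def word_tape_def)
next
  case (Suc t)
  obtain q' tape' h' where c: "(tm_step M ^^ t) (tm_init M w) = (q', tape', h')"
    by (cases "(tm_step M ^^ t) (tm_init M w)")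
  obtain p x m where tr: "tm_trans M q' (tape' h') = (p, x, m)"
    by (cases "tm_trans M q' (tape' h')")
  show ?case
    using Suc.IH[OF c] Suc.prems c tr by (cases m) (auto split: if_splits)
qed

lemma tm_output_length:
  assumes "(tm_step M ^^ t) (tm_init M w) = (q, word_tape u, h)"
  shows "length u \<le> length w + t"
proof (rule ccontr)
  assume "\<not> ?thesis"
  then have "word_tape u (length u) = Blank"
    using tm_run_extent[OF assms] by auto
  with \<open>\<not> ?thesis\<close> show False
    by (auto simp: word_tape_def split: if_splits)
qed

section \<open>Sequential composition of Turing machines\<close>

text \<open>
  The state \<open>q\<close> of \<open>M\<close> becomes \<open>2 * q\<close> and the state \<open>q\<close> of \<open>N\<close> becomes \<open>2 * q + 1\<close>. The
  final states of \<open>M\<close> serve as rewinding states: they move left up to the end marker and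
  then hand over to \<open>N\<close>. Symbols foreign to the machine that is being simulated never occur
  in a run that starts from an input word; looping on them merely makes the transition
  function well-formed on the union of the two alphabets.
\<close>

definition seq_tm :: "tm \<Rightarrow> tm \<Rightarrow> tm" where
  "seq_tm M N = \<lparr>
     tm_states = (\<lambda>q. 2 * q) ` tm_states M \<union> (\<lambda>q. 2 * q + 1) ` tm_states N,
     tm_letters = tm_letters M \<union> tm_letters N,
     tm_start = 2 * tm_start M,
     tm_final = (\<lambda>q. 2 * q + 1) ` tm_final N,
     tm_trans = (\<lambda>q c.
       if even q then
         if q div 2 \<in> tm_final M then
           if c = LeftEnd then (2 * tm_start N + 1, LeftEnd, Stay) else (q, c, MoveL)
         else if c \<in> tm_cells M then
           case tm_trans M (q div 2) c of (q', c', m) \<Rightarrow> (2 * q', c', m)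
         else (q, c, Stay)
       else if c \<in> tm_cells N then
         case tm_trans N (q div 2) c of (q', c', m) \<Rightarrow> (2 * q' + 1, c', m)
       else (q, c, Stay))\<rparr>"

lemma tm_cells_seq: "tm_cells (seq_tm M N) = tm_cells M \<union> tm_cells N"
  by (auto simp: tm_cells_def seq_tm_def)

lemma valid_tm_transD:
  assumes "valid_tm \<Sigma> M" "q \<in> tm_states M" "q \<notin> tm_final M" "c \<in> tm_cells M"
    "tm_trans M q c = (q', c', m)"
  shows "q' \<in> tm_states M" "c' \<in> tm_cells M" "c' = LeftEnd \<longleftrightarrow> c = LeftEnd"
    "c = LeftEnd \<Longrightarrow> m \<noteq> MoveL"
  using assms unfolding valid_tm_def by blast+

lemma valid_tm_seq:
  assumes M: "valid_tm \<Sigma> M" and N: "valid_tm \<Sigma> N"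
  shows "valid_tm \<Sigma> (seq_tm M N)"
proof -
  let ?S = "seq_tm M N"
  have "q' \<in> tm_states ?S \<and> c' \<in> tm_cells ?S \<and>
      (c' = LeftEnd \<longleftrightarrow> c = LeftEnd) \<and> (c = LeftEnd \<longrightarrow> m \<noteq> MoveL)"
    if q: "q \<in> tm_states ?S" "q \<notin> tm_final ?S" and c: "c \<in> tm_cells ?S"
      and tr: "tm_trans ?S q c = (q', c', m)" for q c q' c' m
  proof (cases "even q")
    case True
    then obtain p where p: "q = 2 * p" "p \<in> tm_states M"
      using q(1) by (auto simp: seq_tm_def)
    obtain p' x k where t: "tm_trans M p c = (p', x, k)"
      by (cases "tm_trans M p c")
    have "tm_start N \<in> tm_states N"
      using N by (simp add: valid_tm_def)
    then show ?thesis
      using p c tr t valid_tm_transD[OF M p(2) _ _ t] unfolding tm_cells_seq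
      by (auto simp: seq_tm_def tm_cells_def split: if_splits)
  next
    case False
    then obtain p where p: "q = 2 * p + 1" "p \<in> tm_states N" "p \<notin> tm_final N"
      using q by (auto simp: seq_tm_def)
    obtain p' x k where t: "tm_trans N p c = (p', x, k)"
      by (cases "tm_trans N p c")
    show ?thesis
      using p c tr t valid_tm_transD[OF N p(2,3) _ t] unfolding tm_cells_seq
      by (auto simp: seq_tm_def split: if_splits)
  qed
  moreover have "finite (tm_states ?S)" "finite (tm_letters ?S)" "\<Sigma> \<subseteq> tm_letters ?S"
      "tm_start ?S \<in> tm_states ?S" "tm_final ?S \<subseteq> tm_states ?S"
    using M N by (auto simp: valid_tm_def seq_tm_def)
  ultimately show ?thesis
    unfolding valid_tm_def by blast
qed

lemma even_state_not_final_seq: "2 * q \<notin> tm_final (seq_tm M N)"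
  by (auto simp: seq_tm_def) presburger

text \<open>
  A halted configuration of \<open>M\<close> is a fixed point for \<open>M\<close> but not for the composition, which
  starts to rewind. Hence the simulation of \<open>t\<close> steps may take fewer than \<open>t\<close> steps.
\<close>

lemma seq_tm_simulates_first:
  assumes "valid_tm \<Sigma> M" "tm_config_ok M c"
  shows "\<exists>t' \<le> t. (tm_step (seq_tm M N) ^^ t') (map_prod ((*) 2) id c) =
           map_prod ((*) 2) id ((tm_step M ^^ t) c)"
  using assms(2)
proof (induction t arbitrary: c)
  case 0
  then show ?case by simp
next
  case (Suc t)
  obtain q tape h where c: "c = (q, tape, h)"
    by (cases c)
  show ?case
  proof (cases "q \<in> tm_final M")
    case True
    then have "(tm_step M ^^ Suc t) c = c"
      unfolding c by (rule tm_final_funpow)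
    then show ?thesis
      by (intro exI[of _ 0]) simp
  next
    case False
    have "tape h \<in> tm_cells M"
      using Suc.prems by (auto simp: c tm_config_ok_def)
    with False have step:
      "tm_step (seq_tm M N) (map_prod ((*) 2) id c) = map_prod ((*) 2) id (tm_step M c)"
      using even_state_not_final_seq[of q M N] by (simp add: c) (simp add: seq_tm_def split: prod.split)
    obtain t' where "t' \<le> t" "(tm_step (seq_tm M N) ^^ t') (map_prod ((*) 2) id (tm_step M c)) =
        map_prod ((*) 2) id ((tm_step M ^^ t) (tm_step M c))"
      using Suc.IH[OF tm_config_ok_step[OF assms(1) Suc.prems]] by blast
    then show ?thesis
      using step by (intro exI[of _ "Suc t'"]) (simp add: funpow_swap1 id_def)
  qed
qed

lemma seq_tm_rewinds:
  assumes "q \<in> tm_final M"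
  shows "(tm_step (seq_tm M N) ^^ Suc h) (2 * q, word_tape u, h) =
           (2 * tm_start N + 1, word_tape u, 0)"
proof (induction h)
  case 0
  have "word_tape u 0 = LeftEnd"
    by (simp add: word_tape_def)
  then show ?case
    using assms even_state_not_final_seq[of q M N]
    by simp (simp add: seq_tm_def fun_upd_idem)
next
  case (Suc h)
  have "word_tape u (Suc h) \<noteq> LeftEnd"
    by (simp add: word_tape_def)
  then have "tm_step (seq_tm M N) (2 * q, word_tape u, Suc h) = (2 * q, word_tape u, h)"
    using assms even_state_not_final_seq[of q M N]
    by simp (simp add: seq_tm_def)
  with Suc.IH show ?case
    by (simp add: funpow_swap1)
qed

lemma seq_tm_simulates_second:
  assumes "valid_tm \<Sigma> N" "tm_config_ok N c"
  shows "(tm_step (seq_tm M N) ^^ t) (map_prod (\<lambda>q. 2 * q + 1) id c) =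
           map_prod (\<lambda>q. 2 * q + 1) id ((tm_step N ^^ t) c)"
  using assms(2)
proof (induction t arbitrary: c)
  case 0
  then show ?case by simp
next
  case (Suc t)
  obtain q tape h where c: "c = (q, tape, h)"
    by (cases c)
  have "tape h \<in> tm_cells N"
    using Suc.prems by (auto simp: c tm_config_ok_def)
  then have "tm_step (seq_tm M N) (map_prod (\<lambda>q. 2 * q + 1) id c) =
      map_prod (\<lambda>q. 2 * q + 1) id (tm_step N c)"
    by (auto simp: c seq_tm_def split: prod.split)
  with Suc.IH[OF tm_config_ok_step[OF assms(1) Suc.prems]] show ?case
    by (simp add: funpow_swap1 id_def)
qed

text \<open>
  The three summands of the bound are the run of \<open>M\<close>, the rewinding, and the run of \<open>N\<close> on a
  word that is longer than the input by at most the running time of \<open>M\<close>.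
\<close>

lemma seq_tm_computes_comp:
  fixes p q :: "nat poly"
  assumes M: "valid_tm \<Sigma> M" "tm_computes_in_time \<Sigma> M f (poly p)"
    and N: "valid_tm \<Sigma> N" "tm_computes_in_time \<Sigma> N g (poly q)"
    and f: "f ` lists \<Sigma> \<subseteq> lists \<Sigma>"
  shows "tm_computes_in_time \<Sigma> (seq_tm M N) (g \<circ> f)
           (\<lambda>n. poly p n + Suc (poly p n) + poly q (n + poly p n))"
  unfolding tm_computes_in_time_def
proof
  fix w assume w: "w \<in> lists \<Sigma>"
  let ?S = "seq_tm M N" and ?n = "length w"
  obtain t1 r h where t1: "t1 \<le> poly p ?n"
    and run1: "(tm_step M ^^ t1) (tm_init M w) = (r, word_tape (f w), h)" and r: "r \<in> tm_final M"
    using M(2) w unfolding tm_computes_in_time_def by blast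
  have fw: "f w \<in> lists \<Sigma>"
    using f imageI[OF w] by (rule subsetD)
  obtain t2 r' h' where t2: "t2 \<le> poly q (length (f w))"
    and run2: "(tm_step N ^^ t2) (tm_init N (f w)) = (r', word_tape (g (f w)), h')"
    and r': "r' \<in> tm_final N"
    using N(2) fw unfolding tm_computes_in_time_def by blast
  have h: "h \<le> poly p ?n"
    using tm_run_extent[OF run1] t1 by simp
  have "length (f w) \<le> ?n + poly p ?n"
    using tm_output_length[OF run1] t1 by simp
  then have "poly q (length (f w)) \<le> poly q (?n + poly p ?n)"
    by (rule poly_nat_mono)
  with t2 have t2': "t2 \<le> poly q (?n + poly p ?n)"
    by simp
  have "tm_start M \<in> tm_states M" "tm_start N \<in> tm_states N"
    using M(1) N(1) by (auto simp: valid_tm_def)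
  then have ok: "tm_config_ok M (tm_init M w)" "tm_config_ok N (tm_init N (f w))"
    unfolding tm_init_def
    using tm_config_ok_word_tape[OF M(1) w] tm_config_ok_word_tape[OF N(1) fw] by blast+
  obtain t1' where "t1' \<le> t1"
    and first: "(tm_step ?S ^^ t1') (tm_init ?S w) = (2 * r, word_tape (f w), h)"
    using seq_tm_simulates_first[OF M(1) ok(1), of t1 N] run1
    by (auto simp: tm_init_def seq_tm_def)
  have second: "(tm_step ?S ^^ t2) (2 * tm_start N + 1, word_tape (f w), 0) =
      (2 * r' + 1, word_tape (g (f w)), h')"
    using seq_tm_simulates_second[OF N(1) ok(2), of t2 M] run2 by (simp add: tm_init_def)
  have "(tm_step ?S ^^ (t2 + (Suc h + t1'))) (tm_init ?S w) =
      (2 * r' + 1, word_tape ((g \<circ> f) w), h')"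
    unfolding funpow_add comp_apply first seq_tm_rewinds[OF r] second by simp
  moreover have "2 * r' + 1 \<in> tm_final ?S"
    using r' by (simp add: seq_tm_def)
  moreover have "t2 + (Suc h + t1') \<le> poly p ?n + Suc (poly p ?n) + poly q (?n + poly p ?n)"
    using \<open>t1' \<le> t1\<close> t1 h t2' by linarith
  ultimately show "\<exists>t \<le> poly p ?n + Suc (poly p ?n) + poly q (?n + poly p ?n). \<exists>s h.
      (tm_step ?S ^^ t) (tm_init ?S w) = (s, word_tape ((g \<circ> f) w), h) \<and> s \<in> tm_final ?S"
    by blast
qed

lemma ptime_computable_comp:
  assumes "ptime_computable \<Sigma> f" "ptime_computable \<Sigma> g"
  shows "ptime_computable \<Sigma> (g \<circ> f)"
proof -
  obtain M and p :: "nat poly" where f: "f ` lists \<Sigma> \<subseteq> lists \<Sigma>"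
    and M: "valid_tm \<Sigma> M" "tm_computes_in_time \<Sigma> M f (poly p)"
    using assms(1) unfolding ptime_computable_iff_nat_poly by blast
  obtain N and q :: "nat poly" where g: "g ` lists \<Sigma> \<subseteq> lists \<Sigma>"
    and N: "valid_tm \<Sigma> N" "tm_computes_in_time \<Sigma> N g (poly q)"
    using assms(2) unfolding ptime_computable_iff_nat_poly by blast
  define r where "r = p + (p + 1) + pcompose q ([:0, 1:] + p)"
  have "tm_computes_in_time \<Sigma> (seq_tm M N) (g \<circ> f) (poly r)"
    using seq_tm_computes_comp[OF M N f]
    by (rule tm_computes_in_time_mono) (simp add: r_def poly_pcompose)
  moreover have "(g \<circ> f) ` lists \<Sigma> \<subseteq> lists \<Sigma>"
    using f g by fastforce
  ultimately show ?thesis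
    unfolding ptime_computable_iff_nat_poly using valid_tm_seq[OF M(1) N(1)] by blast
qed

lemma ptime_computable_id:
  assumes "finite \<Sigma>"
  shows "ptime_computable \<Sigma> id"
proof -
  define M where "M = \<lparr>tm_states = {0}, tm_letters = \<Sigma>, tm_start = 0, tm_final = {0},
    tm_trans = (\<lambda>q c. (q, c, Stay))\<rparr>"
  have "valid_tm \<Sigma> M"
    using assms by (simp add: valid_tm_def M_def)
  moreover have "tm_computes_in_time \<Sigma> M id (poly 0)"
    by (simp add: tm_computes_in_time_def tm_init_def M_def)
  ultimately show ?thesis
    unfolding ptime_computable_iff_nat_poly by auto
qed

section \<open>Words over generators\<close>

lemma word_prod_simps [simp]:
  "word_prod G [] = \<one>\<^bsub>G\<^esub>"
  "word_prod G (x # xs) = x \<otimes>\<^bsub>G\<^esub> word_prod G xs"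
  by (simp_all add: word_prod_def)

lemma word_prod_carrier_update: "word_prod (G\<lparr>carrier := H\<rparr>) = word_prod G"
  by (simp add: word_prod_def fun_eq_iff)

context group
begin

lemma word_prod_closed [simp]: "set ws \<subseteq> carrier G \<Longrightarrow> word_prod G ws \<in> carrier G"
  by (induction ws) auto

lemma word_prod_append:
  "set us \<subseteq> carrier G \<Longrightarrow> set vs \<subseteq> carrier G \<Longrightarrow>
     word_prod G (us @ vs) = word_prod G us \<otimes> word_prod G vs"
  by (induction us) (auto simp: m_assoc)

lemma word_prod_concat:
  "(\<And>x. x \<in> set ws \<Longrightarrow> set (u x) \<subseteq> carrier G \<and> word_prod G (u x) = x) \<Longrightarrow>
     word_prod G (concat (map u ws)) = word_prod G ws"
proof (induction ws)
  case (Cons x ws)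
  have "set (concat (map u ws)) \<subseteq> carrier G"
    using Cons.prems by auto
  then show ?case
    using Cons by (simp add: word_prod_append)
qed simp

lemma generate_imp_word_prod:
  assumes "A \<subseteq> carrier G" "g \<in> generate G A"
  shows "\<exists>ws \<in> lists (A \<union> m_inv G ` A). word_prod G ws = g"
  using assms(2)
proof induction
  case one
  show ?case
    by (intro bexI[of _ "[]"]) auto
next
  case (incl h)
  then show ?case
    using assms(1) by (intro bexI[of _ "[h]"]) auto
next
  case (inv h)
  then show ?case
    using assms(1) by (intro bexI[of _ "[inv h]"]) auto
next
  case (eng h1 h2)
  obtain us vs where w: "us \<in> lists (A \<union> m_inv G ` A)" "word_prod G us = h1"
      "vs \<in> lists (A \<union> m_inv G ` A)" "word_prod G vs = h2"
    using eng.IH by blast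
  have "A \<union> m_inv G ` A \<subseteq> carrier G"
    using assms(1) by auto
  with w have "set us \<subseteq> carrier G" "set vs \<subseteq> carrier G"
    by auto
  with w show ?case
    by (intro bexI[of _ "us @ vs"]) (auto simp: word_prod_append)
qed

lemma finite_group_generators_word:
  assumes "finite_group_generators G A" "g \<in> carrier G"
  shows "\<exists>ws \<in> lists (A \<union> m_inv G ` A). word_prod G ws = g"
  using assms generate_imp_word_prod unfolding finite_group_generators_def by blast

lemma word_length_attained:
  assumes "finite_group_generators G A" "g \<in> carrier G"
  obtains ws where "ws \<in> lists (A \<union> m_inv G ` A)" "length ws = word_length G A g"
    "word_prod G ws = g"
proof -
  have "\<exists>n. \<exists>ws \<in> lists (A \<union> m_inv G ` A). length ws = n \<and> word_prod G ws = g"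
    using finite_group_generators_word[OF assms] by blast
  from LeastI_ex[OF this] show thesis
    using that unfolding word_length_def by blast
qed

lemma word_length_le:
  assumes "ws \<in> lists (A \<union> m_inv G ` A)"
  shows "word_length G A (word_prod G ws) \<le> length ws"
  unfolding word_length_def using assms by (intro Least_le) blast

lemma finite_semigroup_generators_symmetric:
  assumes "finite_group_generators G A"
  shows "finite_semigroup_generators G (A \<union> m_inv G ` A)"
  using assms finite_group_generators_word[OF assms]
  unfolding finite_semigroup_generators_def finite_group_generators_def by auto

text \<open>
  Substituting for each letter of a shortest word over \<open>B\<close> a fixed word over \<open>A\<close> multiplies the
  length by at most the length of the longest substituted word.
\<close>

lemma word_length_subgroup_le:
  assumes H: "subgroup H G" and A: "finite_group_generators G A"
    and B: "finite_group_generators (G\<lparr>carrier := H\<rparr>) B"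
  obtains K where "\<And>h. h \<in> H \<Longrightarrow> word_length G A h \<le> K * word_length (G\<lparr>carrier := H\<rparr>) B h"
proof -
  interpret H: group "G\<lparr>carrier := H\<rparr>"
    using H by (rule subgroup_imp_group)
  let ?A = "A \<union> m_inv G ` A" and ?B = "B \<union> m_inv (G\<lparr>carrier := H\<rparr>) ` B"
  have AG: "?A \<subseteq> carrier G"
    using A by (auto simp: finite_group_generators_def)
  have BH: "?B \<subseteq> H" and finB: "finite ?B"
    using B H.inv_closed by (auto simp: finite_group_generators_def)
  have "\<forall>x \<in> carrier G. \<exists>u. u \<in> lists ?A \<and> word_prod G u = x"
    using finite_group_generators_word[OF A] by blast
  then obtain u where u: "\<And>x. x \<in> carrier G \<Longrightarrow> u x \<in> lists ?A \<and> word_prod G (u x) = x"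
    by metis
  define K where "K = (\<Sum>x \<in> ?B. length (u x))"
  have K: "length (u x) \<le> K" if "x \<in> ?B" for x
    unfolding K_def using finB that by (intro member_le_sum) auto
  have "word_length G A h \<le> K * word_length (G\<lparr>carrier := H\<rparr>) B h" if "h \<in> H" for h
  proof -
    obtain ws where ws: "ws \<in> lists ?B" "length ws = word_length (G\<lparr>carrier := H\<rparr>) B h"
        "word_prod G ws = h"
      using H.word_length_attained[OF B, of h] \<open>h \<in> H\<close> unfolding word_prod_carrier_update by auto
    let ?v = "concat (map u ws)"
    have uw: "u x \<in> lists ?A \<and> word_prod G (u x) = x" if "x \<in> set ws" for x
    proof (rule u)
      have "x \<in> ?B"
        using that ws(1) by blast
      then show "x \<in> carrier G"
        using BH subgroup.subset[OF H] by blast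
    qed
    then have v: "?v \<in> lists ?A"
      by fastforce
    have "set (u x) \<subseteq> carrier G \<and> word_prod G (u x) = x" if "x \<in> set ws" for x
      using uw[OF that] AG by auto
    then have "word_prod G ?v = h"
      using word_prod_concat[of ws u] ws(3) by simp
    with word_length_le[OF v] have "word_length G A h \<le> length ?v"
      by simp
    also have "\<dots> = (\<Sum>x\<leftarrow>ws. length (u x))"
      by (simp add: length_concat comp_def)
    also have "\<dots> \<le> (\<Sum>x\<leftarrow>ws. K)"
      using ws(1) K by (intro sum_list_mono) auto
    finally show ?thesis
      using ws(2) by (simp add: sum_list_triv mult.commute)
  qed
  then show thesis
    using that by blast
qed

section \<open>Restricting a representation to a subgroup\<close>

lemma word_multiplier:
  assumes rep: "cayley_ptime_representation G S \<Sigma> L \<psi>" and S: "S \<subseteq> carrier G"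
    and ws: "ws \<in> lists S"
  shows "\<exists>f. ptime_computable \<Sigma> f \<and> f ` L \<subseteq> L \<and> (\<forall>w \<in> L. \<psi> (f w) = \<psi> w \<otimes> word_prod G ws)"
  using ws
proof (induction rule: lists.induct)
  case Nil
  have "finite \<Sigma>" and "\<And>w. w \<in> L \<Longrightarrow> \<psi> w \<in> carrier G"
    using rep by (auto simp: cayley_ptime_representation_def bij_betw_def)
  then show ?case
    using ptime_computable_id[of \<Sigma>] by (intro exI[of _ id]) (auto simp: id_def)
next
  case (Cons s ws)
  obtain f where f: "ptime_computable \<Sigma> f" "f ` L \<subseteq> L" "\<forall>w \<in> L. \<psi> (f w) = \<psi> w \<otimes> s"
    using rep Cons.hyps(1) unfolding cayley_ptime_representation_def by blast
  obtain g where g: "ptime_computable \<Sigma> g" "g ` L \<subseteq> L"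
      "\<forall>w \<in> L. \<psi> (g w) = \<psi> w \<otimes> word_prod G ws"
    using Cons.IH by blast
  have "\<And>w. w \<in> L \<Longrightarrow> \<psi> w \<in> carrier G" and "s \<in> carrier G" and "set ws \<subseteq> carrier G"
    using rep S Cons.hyps by (auto simp: cayley_ptime_representation_def bij_betw_def)
  then have "\<forall>w \<in> L. \<psi> ((g \<circ> f) w) = \<psi> w \<otimes> word_prod G (s # ws)"
    using f(2,3) g(3) by (auto simp: m_assoc image_subset_iff)
  moreover have "(g \<circ> f) ` L \<subseteq> L"
    using f(2) g(2) by auto
  ultimately show ?case
    using ptime_computable_comp[OF f(1) g(1)] by blast
qed

lemma cayley_ptime_representation_subgroup:
  assumes rep: "cayley_ptime_representation G S \<Sigma> L \<psi>" and S: "finite_semigroup_generators G S"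
    and H: "subgroup H G" and T: "T \<subseteq> H"
  shows "cayley_ptime_representation (G\<lparr>carrier := H\<rparr>) T \<Sigma> {w \<in> L. \<psi> w \<in> H} \<psi>"
proof -
  have bij: "bij_betw \<psi> L (carrier G)"
    using rep by (simp add: cayley_ptime_representation_def)
  have "bij_betw \<psi> {w \<in> L. \<psi> w \<in> H} H"
  proof (rule bij_betw_subset[OF bij])
    show "\<psi> ` {w \<in> L. \<psi> w \<in> H} = H"
      using subgroup.subset[OF H]
      unfolding bij_betw_imp_surj_on[OF bij, symmetric] by blast
  qed auto
  moreover have "\<exists>f. ptime_computable \<Sigma> f \<and> f ` {w \<in> L. \<psi> w \<in> H} \<subseteq> {w \<in> L. \<psi> w \<in> H} \<and>
      (\<forall>w \<in> {w \<in> L. \<psi> w \<in> H}. \<psi> (f w) = \<psi> w \<otimes> b)" if "b \<in> T" for b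
  proof -
    have b: "b \<in> H" "b \<in> carrier G"
      using that T subgroup.subset[OF H] by auto
    obtain ws where "ws \<in> lists S" "word_prod G ws = b"
      using S b(2) unfolding finite_semigroup_generators_def by blast
    moreover have "S \<subseteq> carrier G"
      using S by (simp add: finite_semigroup_generators_def)
    ultimately obtain f where f: "ptime_computable \<Sigma> f" "f ` L \<subseteq> L"
        "\<forall>w \<in> L. \<psi> (f w) = \<psi> w \<otimes> b"
      using word_multiplier[OF rep] by blast
    then show ?thesis
      using subgroup.m_closed[OF H _ b(1)] by (intro exI[of _ f]) auto
  qed
  ultimately show ?thesis
    using rep by (auto simp: cayley_ptime_representation_def)
qed

lemma quasigeodesic_normal_form_subgroup:
  assumes qg: "quasigeodesic_normal_form G A L \<psi>"
    and H: "subgroup H G" and A: "finite_group_generators G A"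
    and B: "finite_group_generators (G\<lparr>carrier := H\<rparr>) B"
  shows "quasigeodesic_normal_form (G\<lparr>carrier := H\<rparr>) B {w \<in> L. \<psi> w \<in> H} \<psi>"
proof -
  obtain C :: real where C: "\<And>w. w \<in> L \<Longrightarrow> real (length w) \<le> C * (real (word_length G A (\<psi> w)) + 1)"
    using qg unfolding quasigeodesic_normal_form_def by blast
  obtain K where K: "\<And>h. h \<in> H \<Longrightarrow> word_length G A h \<le> K * word_length (G\<lparr>carrier := H\<rparr>) B h"
    using word_length_subgroup_le[OF H A B] by blast
  \<comment> \<open>The sign of \<open>C\<close> is unknown if \<open>L\<close> is empty; \<open>K + 1\<close> absorbs the additive constant,
    as \<open>K * d + 1 \<le> (K + 1) * (d + 1)\<close>.\<close>
  have "real (length w) \<le> \<bar>C\<bar> * (K + 1) * (real (word_length (G\<lparr>carrier := H\<rparr>) B (\<psi> w)) + 1)"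
    if w: "w \<in> L" "\<psi> w \<in> H" for w
  proof -
    let ?d = "word_length (G\<lparr>carrier := H\<rparr>) B (\<psi> w)"
    have "word_length G A (\<psi> w) + 1 \<le> (K + 1) * (?d + 1)"
      using K[OF w(2)] by simp
    then have d: "real (word_length G A (\<psi> w) + 1) \<le> real ((K + 1) * (?d + 1))"
      by (rule of_nat_mono)
    have "real (length w) \<le> C * (real (word_length G A (\<psi> w)) + 1)"
      using w(1) by (rule C)
    also have "\<dots> \<le> \<bar>C\<bar> * (real (word_length G A (\<psi> w)) + 1)"
      by (intro mult_right_mono) auto
    also have "\<dots> = \<bar>C\<bar> * real (word_length G A (\<psi> w) + 1)"
      by simp
    also have "\<dots> \<le> \<bar>C\<bar> * real ((K + 1) * (?d + 1))"
      using d by (intro mult_left_mono) auto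
    finally show ?thesis
      by (simp add: algebra_simps)
  qed
  then show ?thesis
    unfolding quasigeodesic_normal_form_def by auto
qed

end

theorem theorem13:
  fixes G :: "('a, 'b) monoid_scheme" and H :: "'a set"
  assumes "group G"
    and "subgroup H G"
    and "finitely_generated_group (G\<lparr>carrier := H\<rparr>)"
  shows "(cayley_ptime_group G \<longrightarrow> cayley_ptime_group (G\<lparr>carrier := H\<rparr>)) \<and>
         (cayley_ptime_quasigeodesic_group G \<longrightarrow>
            cayley_ptime_quasigeodesic_group (G\<lparr>carrier := H\<rparr>))"
proof -
  let ?H = "G\<lparr>carrier := H\<rparr>"
  interpret group G by fact
  interpret H: group ?H
    using assms(2) by (rule subgroup_imp_group)
  obtain B where B: "finite_group_generators ?H B"
    using assms(3) unfolding finitely_generated_group_def by blast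
  define T where "T = B \<union> m_inv ?H ` B"
  have T: "finite_semigroup_generators ?H T"
    unfolding T_def using B by (rule H.finite_semigroup_generators_symmetric)
  then have "T \<subseteq> H"
    by (simp add: finite_semigroup_generators_def)
  note restrict = cayley_ptime_representation_subgroup[OF _ _ assms(2) this]
    and qg = quasigeodesic_normal_form_subgroup[OF _ assms(2) _ B]
  show ?thesis
  proof (intro conjI impI)
    assume "cayley_ptime_group G"
    then obtain S \<Sigma> L \<psi> where "finite_semigroup_generators G S"
        "cayley_ptime_representation G S \<Sigma> L \<psi>"
      unfolding cayley_ptime_group_def by blast
    with restrict assms(3) T show "cayley_ptime_group ?H"
      unfolding cayley_ptime_group_def by blast
  next
    assume "cayley_ptime_quasigeodesic_group G"
    then obtain S A \<Sigma> L \<psi> where rep: "finite_semigroup_generators G S"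
        "cayley_ptime_representation G S \<Sigma> L \<psi>"
      and A: "finite_group_generators G A" "quasigeodesic_normal_form G A L \<psi>"
      unfolding cayley_ptime_quasigeodesic_group_def by blast
    with assms(3) B T restrict[OF rep(2,1)] qg[OF A(2,1)]
    show "cayley_ptime_quasigeodesic_group ?H"
      unfolding cayley_ptime_quasigeodesic_group_def by blast
  qed
qed

end
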